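(* Let $x$ be a bordered word of length $n \geq 1$ and let $e = \operatorname{ice}(x)$. Then $$\operatorname{nnp}(x) \leq \frac{e}{2} + 1 + \frac{\ln(n/2)}{\ln\bigl(e/(e-1)\bigr)}.$$
   Context: Let $x$ be a finite nonempty word of length $n$. An integer $p$ with $1 \le p \le n$ is a period of $x$ if $x[i]=x[i+p]$ for all $1 \le i \le n-p$. A period is nontrivial if $p<n$. $\operatorname{nnp}(x)$ denotes the number of nontrivial periods of $x$, and $\operatorname{per}(x)$ denotes the least period of $x$. The exponent of $x$ is $\exp(x) = |x|/\operatorname{per}(x)$. The initial critical exponent of $x$ is $\operatorname{ice}(x) = \sup\{\exp(w) : w \text{ a nonempty prefix of } x\}$. A border of $x$ is a word $w$ with $0<|w|<|x|$ that is both a prefix and a suffix of $x$ (overlapping allowed); $x$ is bordered if it has at least one border. *)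

theory Defs
  imports Complex_Main "HOL-Library.Sublist"
begin

text \<open>
  Finite words over an arbitrary alphabet are lists. Letters are indexed from 0 here,
  so the \<open>i\<close>-th letter in the usual 1-based indexing is \<open>x ! (i - 1)\<close>.
\<close>

definition is_period :: "'a list \<Rightarrow> nat \<Rightarrow> bool" where
  "is_period x p \<longleftrightarrow>
     1 \<le> p \<and> p \<le> length x \<and> (\<forall>i. i + p < length x \<longrightarrow> x ! i = x ! (i + p))"

definition nnp :: "'a list \<Rightarrow> nat" where
  "nnp x = card {p. is_period x p \<and> p < length x}"

definition per :: "'a list \<Rightarrow> nat" where
  "per x = (LEAST p. is_period x p)"

definition exponent :: "'a list \<Rightarrow> real" where
  "exponent x = real (length x) / real (per x)"

definition ice :: "'a list \<Rightarrow> real" where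
  "ice x = Sup {exponent w | w. prefix w x \<and> w \<noteq> []}"

definition is_border :: "'a list \<Rightarrow> 'a list \<Rightarrow> bool" where
  "is_border w x \<longleftrightarrow> 0 < length w \<and> length w < length x \<and> prefix w x \<and> suffix w x"

definition bordered :: "'a list \<Rightarrow> bool" where
  "bordered x \<longleftrightarrow> (\<exists>w. is_border w x)"

end

theory Submission
  imports Defs
begin

text \<open>
  Split the nontrivial periods at \<open>n/2\<close>. By the weak form of the Fine--Wilf theorem, every period
  \<open>\<le> n/2\<close> is a multiple of the least one, so there are at most \<open>e/2\<close> of them. The periods \<open>> n/2\<close>
  correspond to borders of length \<open>< n/2\<close>; if \<open>b < c\<close> are border lengths, then the prefix of
  length \<open>c\<close> has period \<open>c - b\<close>, so \<open>c \<le> e (c - b)\<close>. Hence the border lengths grow at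
  least geometrically with ratio \<open>e / (e - 1)\<close>.
\<close>

text \<open>The full length is vacuously a period, so the least period exists.\<close>

lemma is_period_per: "w \<noteq> [] \<Longrightarrow> is_period w (per w)"
  unfolding per_def by (rule LeastI[of _ "length w"]) (auto simp: is_period_def Suc_le_eq)

lemma per_le: "is_period w p \<Longrightarrow> per w \<le> p"
  unfolding per_def by (rule Least_le)

lemma per_pos: "w \<noteq> [] \<Longrightarrow> 0 < per w"
  using is_period_per[of w] by (auto simp: is_period_def)

lemma exponent_ge:
  assumes "is_period w p"
  shows "real (length w) / real p \<le> exponent w"
proof -
  have "w \<noteq> []" using assms by (auto simp: is_period_def)
  then show ?thesis
    unfolding exponent_def using per_le[OF assms] per_pos[of w]
    by (intro divide_left_mono) auto
qed

lemma exponent_le_length: "w \<noteq> [] \<Longrightarrow> exponent w \<le> real (length w)"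
  using per_pos[of w] mult_left_mono[of 1 "real (per w)" "real (length w)"]
  by (simp add: exponent_def divide_le_eq)

lemma exponent_prefix_le_ice:
  assumes "prefix w x" "w \<noteq> []"
  shows "exponent w \<le> ice x"
  unfolding ice_def
proof (rule cSup_upper)
  \<comment> \<open>A real \<open>Sup\<close> is an upper bound only for a set bounded above;
    \<open>length x\<close> serves as the bound.\<close>
  show "bdd_above {exponent w |w. prefix w x \<and> w \<noteq> []}"
  proof (rule bdd_aboveI)
    fix r assume "r \<in> {exponent w |w. prefix w x \<and> w \<noteq> []}"
    then obtain v where "r = exponent v" "prefix v x" "v \<noteq> []" by blast
    then show "r \<le> real (length x)"
      using exponent_le_length[of v] prefix_length_le[of v x] by linarith
  qed
qed (use assms in blast)

text \<open>From position \<open>i\<close>, step back by \<open>p\<close> and then forward by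
  \<open>q\<close>. If \<open>i < p\<close>, go forward by \<open>q\<close> first:
  \<open>p + q \<le> length x\<close> keeps \<open>i + q\<close> inside the word.\<close>

lemma is_period_diff:
  assumes p: "is_period x p" and q: "is_period x q" and "p < q" "p + q \<le> length x"
  shows "is_period x (q - p)"
proof -
  have "x ! i = x ! (i + (q - p))" if i: "i + (q - p) < length x" for i
  proof (cases "p \<le> i")
    case True
    have "x ! (i - p) = x ! i" using p True i unfolding is_period_def
      by (metis add_lessD1 le_add_diff_inverse2)
    moreover have "x ! (i - p) = x ! (i - p + q)"
      using q True i \<open>p < q\<close> unfolding is_period_def by auto
    moreover have "i - p + q = i + (q - p)" using True \<open>p < q\<close> by simp
    ultimately show ?thesis by simp
  next
    case False
    then have l: "i + q < length x" using assms(4) by simp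
    then have "x ! i = x ! (i + q)" using q by (auto simp: is_period_def)
    moreover have "x ! (i + (q - p)) = x ! (i + (q - p) + p)"
      using p l \<open>p < q\<close> by (auto simp: is_period_def)
    moreover have "i + (q - p) + p = i + q" using \<open>p < q\<close> by simp
    ultimately show ?thesis by simp
  qed
  then show ?thesis using assms by (auto simp: is_period_def)
qed

text \<open>Subtract \<open>per x\<close> repeatedly: \<open>q\<close> stays a period, and since
  none is below \<open>per x\<close>, the descent ends exactly there.\<close>

lemma per_dvd_period:
  assumes "is_period x q" "per x + q \<le> length x"
  shows "per x dvd q"
  using assms
proof (induction q rule: less_induct)
  case (less q)
  have "x \<noteq> []" using less.prems by (auto simp: is_period_def)
  note p = is_period_per[OF this] per_pos[OF this]
  show ?case
  proof (cases "q = per x")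
    case False
    then have lt: "per x < q" using per_le[OF less.prems(1)] by simp
    have "is_period x (q - per x)"
      using is_period_diff[OF p(1) less.prems(1) lt less.prems(2)] .
    moreover have "q - per x < q" "per x + (q - per x) \<le> length x"
      using lt p(2) less.prems(2) by linarith+
    ultimately have "per x dvd q - per x" using less.IH by blast
    then show ?thesis using lt by (simp add: dvd_minus_self)
  qed simp
qed

lemma card_short_periods_le:
  assumes "x \<noteq> []"
  shows "real (card {p. is_period x p \<and> 2 * p \<le> length x}) \<le> exponent x / 2"
proof -
  let ?S = "{p. is_period x p \<and> 2 * p \<le> length x}"
  \<comment> \<open>The number of positive multiples of \<open>per x\<close> up to half the
    length.\<close>
  let ?m = "length x div (2 * per x)"
  note pos = per_pos[OF assms]
  have "?S \<subseteq> (\<lambda>k. per x * k) ` {1..?m}"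
  proof
    fix q assume "q \<in> ?S"
    then have q: "is_period x q" "2 * q \<le> length x" by auto
    then have "per x + q \<le> length x" using per_le[OF q(1)] by simp
    then obtain k where k: "q = per x * k" using per_dvd_period[OF q(1)] by blast
    have "1 \<le> k" using q(1) k by (cases k) (auto simp: is_period_def)
    moreover have "k \<le> ?m"
      using q(2) pos unfolding k by (simp add: less_eq_div_iff_mult_less_eq mult.commute mult.left_commute)
    ultimately show "q \<in> (\<lambda>k. per x * k) ` {1..?m}" using k by auto
  qed
  then have "card ?S \<le> ?m" using surj_card_le[of "{1..?m}" ?S] by auto
  moreover have "real ?m \<le> real (length x) / real (2 * per x)" by (rule of_nat_div_le_of_nat)
  ultimately show ?thesis by (simp add: exponent_def field_simps)
qed

text \<open>The least element is at least 1, and each further element, added as a new maximum,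
  contributes a factor \<open>r\<close>.\<close>

lemma geometric_set_card_bound:
  fixes B :: "nat set" and r :: real
  assumes "finite B" "B \<noteq> {}" "\<And>b. b \<in> B \<Longrightarrow> 0 < b" "1 \<le> r"
    and "\<And>b c. b \<in> B \<Longrightarrow> c \<in> B \<Longrightarrow> b < c \<Longrightarrow> r * real b \<le> real c"
  shows "r ^ (card B - 1) \<le> real (Max B)"
  using assms
proof (induction B rule: finite_linorder_max_induct)
  case (insert c A)
  have Max: "Max (insert c A) = c"
    using insert.hyps by (intro Max_eqI) (auto simp: less_imp_le)
  have card: "card (insert c A) = Suc (card A)"
    using insert.hyps by (auto simp: card_insert_if)
  show ?case
  proof (cases "A = {}")
    case True
    then show ?thesis using insert.prems(2)[of c] by simp
  next
    case False
    have "r ^ card A = r * r ^ (card A - 1)"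
      using False insert.hyps(1) by (metis card_gt_0_iff power_minus_mult mult.commute)
    also have "\<dots> \<le> r * real (Max A)"
      using False insert.prems insert.IH by (intro mult_left_mono) auto
    also have "\<dots> \<le> real c"
      using False insert.hyps by (intro insert.prems(4)) auto
    finally show ?thesis unfolding Max card by simp
  qed
qed simp

text \<open>The prefix is the border belonging to \<open>q\<close>. Shifting by \<open>p\<close> and
  back by \<open>q\<close> stays inside \<open>x\<close>, because
  \<open>i + p < length x\<close>.\<close>

lemma is_period_take_border:
  assumes p: "is_period x p" and q: "is_period x q" and "q < p"
  shows "is_period (take (length x - q) x) (p - q)"
proof -
  have "x ! i = x ! (i + (p - q))" if i: "i + (p - q) < length x - q" for i
  proof -
    have "x ! i = x ! (i + p)" using p i by (auto simp: is_period_def)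
    moreover have "x ! (i + (p - q)) = x ! (i + (p - q) + q)"
      using q i by (auto simp: is_period_def)
    moreover have "i + (p - q) + q = i + p" using \<open>q < p\<close> by simp
    ultimately show ?thesis by simp
  qed
  then show ?thesis using assms by (auto simp: is_period_def)
qed

lemma card_long_periods_le:
  assumes e: "e = ice x" "1 < e" and n: "2 \<le> length x"
  shows "real (card {p. is_period x p \<and> length x < 2 * p \<and> p < length x})
    \<le> 1 + ln (real (length x) / 2) / ln (e / (e - 1))"
proof -
  let ?n = "length x"
  let ?L = "{p. is_period x p \<and> ?n < 2 * p \<and> p < ?n}"
  \<comment> \<open>The lengths of the borders that belong to the long periods.\<close>
  define B where "B = (\<lambda>p. ?n - p) ` ?L"
  define r where "r = e / (e - 1)"
  have r: "1 < r" using e unfolding r_def by simp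
  have card: "card B = card ?L" unfolding B_def by (rule card_image) (auto simp: inj_on_def)
  show ?thesis
  proof (cases "B = {}")
    case True
    then have "card ?L = 0" using card by simp
    \<comment> \<open>The numerator is nonnegative because the length is at least 2.\<close>
    moreover have "0 \<le> ln (real ?n / 2) / ln r" using r n by simp
    ultimately show ?thesis unfolding r_def by linarith
  next
    case False
    have fin: "finite B" unfolding B_def by simp
    have ratio: "r * real b \<le> real c" if bc: "b \<in> B" "c \<in> B" "b < c" for b c
    proof -
      obtain p q where p: "b = ?n - p" "p \<in> ?L" and q: "c = ?n - q" "q \<in> ?L"
        using bc unfolding B_def by blast
      have "q < p" using p q bc by auto
      have per: "is_period (take c x) (c - b)"
        using is_period_take_border[of x p q] p q \<open>q < p\<close> by simp
      have "real c / real (c - b) \<le> exponent (take c x)"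
        using exponent_ge[OF per] q by simp
      also have "\<dots> \<le> e"
        unfolding e(1) using per
        by (intro exponent_prefix_le_ice take_is_prefix) (auto simp: is_period_def)
      finally have "real c \<le> e * (real c - real b)"
        using bc by (simp add: divide_le_eq of_nat_diff)
      \<comment> \<open>Rearranged, the inequality reads \<open>e * b \<le> (e - 1) * c\<close>;
        divide by \<open>e - 1 > 0\<close>.\<close>
      then show ?thesis using e unfolding r_def by (simp add: field_simps)
    qed
    have "r ^ (card B - 1) \<le> real (Max B)"
      by (rule geometric_set_card_bound) (use fin False r ratio in \<open>auto simp: B_def\<close>)
    also have "\<dots> \<le> real ?n / 2"
      using Max_in[OF fin False] unfolding B_def by auto
    finally have "ln (r ^ (card B - 1)) \<le> ln (real ?n / 2)"
      using r by (intro ln_mono) auto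
    then have "real (card B - 1) * ln r \<le> ln (real ?n / 2)"
      using r by (simp add: ln_realpow)
    then have "real (card B - 1) \<le> ln (real ?n / 2) / ln r"
      using r by (simp add: pos_le_divide_eq)
    then show ?thesis using card unfolding r_def by simp
  qed
qed

text \<open>Shifting by \<open>length u\<close> carries each position of the prefix copy of
  \<open>w\<close> to the same position of the suffix copy.\<close>

lemma is_period_of_border:
  assumes "is_border w x"
  shows "is_period x (length x - length w)"
proof -
  obtain u v where u: "x = u @ w" and v: "x = w @ v"
    using assms by (auto simp: is_border_def prefix_def suffix_def)
  have len: "length x - length w = length u" using u by simp
  have "x ! i = x ! (i + length u)" if "i + length u < length x" for i
  proof -
    have "i < length w" using that u by simp
    then have "x ! i = w ! i" using v by (simp add: nth_append)
    moreover have "x ! (i + length u) = w ! i" using u by (simp add: nth_append)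
    ultimately show ?thesis by simp
  qed
  then show ?thesis using assms len by (auto simp: is_period_def is_border_def)
qed

theorem theorem1:
  fixes x :: "'a list" and n :: nat and e :: real
  assumes "length x = n" and "n \<ge> 1" and "bordered x" and "e = ice x"
  shows "real (nnp x) \<le> e / 2 + 1 + ln (real n / 2) / ln (e / (e - 1))"
proof -
  obtain w where w: "is_border w x" using assms(3) unfolding bordered_def by blast
  then have n: "2 \<le> length x" unfolding is_border_def by linarith
  then have ne: "x \<noteq> []" by auto
  \<comment> \<open>The border makes the exponent, and hence \<open>e\<close>, exceed 1, so that
    \<open>e / (e - 1)\<close> is a ratio above 1.\<close>
  have "per x < length x"
    using per_le[OF is_period_of_border[OF w]] w unfolding is_border_def by linarith
  then have "1 < exponent x" using per_pos[OF ne] by (simp add: exponent_def)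
  moreover have le: "exponent x \<le> e" using exponent_prefix_le_ice[of x x] ne assms(4) by simp
  ultimately have e: "1 < e" by simp
  let ?S = "{p. is_period x p \<and> 2 * p \<le> length x}"
  let ?L = "{p. is_period x p \<and> length x < 2 * p \<and> p < length x}"
  \<comment> \<open>Periods in \<open>?S\<close> are nontrivial, since half of a positive length is
    below that length.\<close>
  have "{p. is_period x p \<and> p < length x} = ?S \<union> ?L"
    using n by auto
  then have "nnp x \<le> card ?S + card ?L"
    unfolding nnp_def by (simp add: card_Un_le)
  then show ?thesis
    using card_short_periods_le[OF ne] le card_long_periods_le[OF assms(4) e n]
    unfolding assms(1) by linarith
qed

end
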